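(* Fix an integer $s\ge1$. For $0\le j\le s$ set $A_j^{(s)}:=\dfrac{(s+1-j)^{2j}}{(2j)!}$ and $B_j^{(s)}:=\dfrac{(s+1-j)^{2j+1}}{(2j+1)!}$, and let $\Delta_s^{\mathrm{vol}}(z):=\sum_{j=0}^{s}(-1)^jA_j^{(s)}z^j$. Define $\mathscr E_s(z)$ and $\mathscr O_s(z)$ as the coefficientwise (in $z$) limits, as $m\to\infty$, of $m^{-2}\mathcal E_m^{(s)}(z/m^2)$ and $m^{-1}\mathcal O_m^{(s)}(z/m^2)$, respectively. Then $$\mathscr E_s(z)=\frac{\sum_{j=0}^{s-1}(-1)^jA_{j+1}^{(s)}z^j}{\Delta_s^{\mathrm{vol}}(z)},\qquad \mathscr O_s(z)=\frac{\sum_{j=0}^{s}(-1)^jB_j^{(s)}z^j}{\Delta_s^{\mathrm{vol}}(z)},$$ and the volume generating function $\mathcal V_s(y):=\sum_{d\ge0}\mathrm{vol}(\mathcal P_d^{(s)})\,y^d$ satisfies $$\mathcal V_s(y)=1+y\bigl(\mathscr O_s(y^2)-1\bigr)+y^2\,\mathscr E_s(y^2).$$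
   Context: For integers $d\ge2$ and $s\ge1$ let $$\mathcal P_d^{(s)}=\{x=(x_1,\dots,x_d)\in\mathbb R_{\ge0}^d:\ x_i+x_{i+1}\le s+\delta_i,\ 1\le i\le d-1\},$$ where $\delta_i=0$ for $i$ odd and $\delta_i=1$ for $i$ even. By convention $\mathcal P_0^{(s)}=\{0\}$ (with volume $1$) and $\mathcal P_1^{(s)}=[0,s]$; $\mathrm{vol}$ is Euclidean $d$-dimensional volume. For $s,m\ge1$ define matrices indexed by $0\le i,j\le (s+1)m$: $(\mathsf X)_{ij}=1$ if $i+j\le sm$ and $0$ otherwise; $(\mathsf Y)_{ij}=1$ if $i+j\le(s+1)m$ and $0$ otherwise; $\mathsf Z=\mathsf X\mathsf Y$; and let $\mathbf e=(1,\dots,1)^\top\in\mathbb R^{(s+1)m+1}$. The parity-split series are the formal power series $$\mathcal O_m^{(s)}(z):=\mathbf e^\top(I-z\mathsf Z)^{-1}\mathbf e,\qquad \mathcal E_m^{(s)}(z):=\mathbf e^\top(I-z\mathsf Z)^{-1}\mathsf X\,\mathbf e.$$ (With $L_d^{(s)}(m):=\#(m\mathcal P_d^{(s)}\cap\mathbb Z^d)$, one has $[z^r]\mathcal O_m^{(s)}=L_{2r+1}^{(s)}(m)$ for $r\ge1$, with constant term $(s+1)m+1$, and $[z^r]\mathcal E_m^{(s)}=L_{2r+2}^{(s)}(m)$ for $r\ge0$.) *)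

theory Defs
  imports
    "HOL-Analysis.Analysis"
    "HOL-Computational_Algebra.Formal_Power_Series"
    "Jordan_Normal_Form.Matrix"
    "Jordan_Normal_Form.Determinant"
begin

definition delta :: "nat \<Rightarrow> nat" where
  "delta i = (if odd i then 0 else 1)"

text \<open>Since the dimension varies, $\mathbb{R}^d$ is the set of extensional functions on
  \<open>{1..d}\<close>. The case \<open>d = 1\<close> carries the extra convention $[0,s]$; for \<open>d = 0\<close> there are no
  constraints and the set is the one-point space $\mathbb{R}^0$.\<close>

definition polytope :: "nat \<Rightarrow> nat \<Rightarrow> (nat \<Rightarrow> real) set" where
  "polytope s d =
    (if d = 1 then {1..d} \<rightarrow>\<^sub>E {0..real s}
     else {x \<in> {1..d} \<rightarrow>\<^sub>E {0..}. \<forall>i\<in>{1..<d}. x i + x (i + 1) \<le> real (s + delta i)})"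

definition vol :: "nat \<Rightarrow> (nat \<Rightarrow> real) set \<Rightarrow> real" where
  "vol d S = measure (Pi\<^sub>M {1..d} (\<lambda>_. lborel)) S"

definition vol_gf :: "nat \<Rightarrow> real fps" where
  "vol_gf s = Abs_fps (\<lambda>d. vol d (polytope s d))"

definition X_mat :: "nat \<Rightarrow> nat \<Rightarrow> real mat" where
  "X_mat s m = Matrix.mat ((s + 1) * m + 1) ((s + 1) * m + 1)
     (\<lambda>(i, j). if i + j \<le> s * m then 1 else 0)"

definition Y_mat :: "nat \<Rightarrow> nat \<Rightarrow> real mat" where
  "Y_mat s m = Matrix.mat ((s + 1) * m + 1) ((s + 1) * m + 1)
     (\<lambda>(i, j). if i + j \<le> (s + 1) * m then 1 else 0)"

definition Z_mat :: "nat \<Rightarrow> nat \<Rightarrow> real mat" where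
  "Z_mat s m = X_mat s m * Y_mat s m"

definition e_vec :: "nat \<Rightarrow> nat \<Rightarrow> real fps Matrix.vec" where
  "e_vec s m = Matrix.vec ((s + 1) * m + 1) (\<lambda>_. 1)"

text \<open>The two-sided inverse; \<open>mat_inv_I_minus_z\<close> below shows that it exists where it is used.\<close>

definition mat_inv :: "'a::comm_ring_1 mat \<Rightarrow> 'a mat" where
  "mat_inv A = (THE B. inverts_mat A B \<and> inverts_mat B A)"

definition I_minus_z :: "real mat \<Rightarrow> real fps mat" where
  "I_minus_z M = 1\<^sub>m (dim_row M) - fps_X \<cdot>\<^sub>m map_mat fps_const M"

definition O_series :: "nat \<Rightarrow> nat \<Rightarrow> real fps" where
  "O_series s m =
     scalar_prod (e_vec s m) (mat_inv (I_minus_z (Z_mat s m)) *\<^sub>v e_vec s m)"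

definition E_series :: "nat \<Rightarrow> nat \<Rightarrow> real fps" where
  "E_series s m =
     scalar_prod (e_vec s m)
       (mat_inv (I_minus_z (Z_mat s m)) *\<^sub>v (map_mat fps_const (X_mat s m) *\<^sub>v e_vec s m))"

lemma mat_inv_I_minus_z:
  assumes M: "M \<in> carrier_mat n n"
  shows "inverts_mat (I_minus_z M) (mat_inv (I_minus_z M))"
    and "inverts_mat (mat_inv (I_minus_z M)) (I_minus_z M)"
proof -
  let ?A = "I_minus_z M"
  have A: "?A \<in> carrier_mat n n"
    using M by (auto simp: I_minus_z_def)
  interpret h: comm_ring_hom "\<lambda>f :: real fps. fps_nth f 0"
    by unfold_locales auto
  have "map_mat (\<lambda>f. fps_nth f 0) ?A = 1\<^sub>m n"
    using M by (auto simp: I_minus_z_def intro!: eq_matI)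
  hence "fps_nth (Determinant.det ?A) 0 = 1"
    using h.hom_det[of ?A] by simp
  hence d: "inverse (Determinant.det ?A) * Determinant.det ?A = 1"
    by (intro inverse_mult_eq_1) simp
  define B where "B = inverse (Determinant.det ?A) \<cdot>\<^sub>m adj_mat ?A"
  have B: "B \<in> carrier_mat n n"
    unfolding B_def using adj_mat(1)[OF A] by simp
  have AB: "?A * B = 1\<^sub>m n"
    unfolding B_def using adj_mat[OF A] A d
    by (auto simp: mult_smult_distrib[OF A adj_mat(1)[OF A]] intro!: eq_matI)
  have BA: "B * ?A = 1\<^sub>m n"
    unfolding B_def using adj_mat[OF A] A d
    by (auto simp: mult_smult_assoc_mat[OF adj_mat(1)[OF A] A] intro!: eq_matI)
  have "mat_inv ?A = B"
    unfolding mat_inv_def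
  proof (rule the_equality)
    show "inverts_mat ?A B \<and> inverts_mat B ?A"
      using A B AB BA by (auto simp: inverts_mat_def)
  next
    fix C assume C: "inverts_mat ?A C \<and> inverts_mat C ?A"
    have eqs: "?A * C = 1\<^sub>m n" "C * ?A = 1\<^sub>m (dim_row C)"
      using C A by (auto simp: inverts_mat_def)
    have "dim_col C = n"
      using arg_cong[OF eqs(1), of dim_col] by simp
    moreover have "dim_row C = n"
      using arg_cong[OF eqs(2), of dim_col] A by simp
    ultimately have Cc: "C \<in> carrier_mat n n" by auto
    have "C = (B * ?A) * C" using BA Cc by simp
    also have "\<dots> = B * (?A * C)" using A B Cc by simp
    also have "\<dots> = B" using eqs(1) B by simp
    finally show "C = B" .
  qed
  with A B AB BA show "inverts_mat ?A (mat_inv ?A)" "inverts_mat (mat_inv ?A) ?A"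
    by (auto simp: inverts_mat_def)
qed

text \<open>The library topology on \<^typ>\<open>real fps\<close> is the $z$-adic one, with discrete coefficients, so
  coefficientwise real convergence is spelled out.\<close>

definition coeffwise_limit :: "(nat \<Rightarrow> real fps) \<Rightarrow> real fps \<Rightarrow> bool" where
  "coeffwise_limit F G \<longleftrightarrow> (\<forall>r. (\<lambda>m. fps_nth (F m) r) \<longlonglongrightarrow> fps_nth G r)"

definition coeffwise_lim :: "(nat \<Rightarrow> real fps) \<Rightarrow> real fps" where
  "coeffwise_lim F = Abs_fps (\<lambda>r. lim (\<lambda>m. fps_nth (F m) r))"

text \<open>$m^{-2} \mathcal{E}_m(z/m^2)$ and $m^{-1} \mathcal{O}_m(z/m^2)$; the junk value at \<open>m = 0\<close>
  does not affect the limits.\<close>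

definition E_scaled :: "nat \<Rightarrow> nat \<Rightarrow> real fps" where
  "E_scaled s m =
     fps_const (1 / real m ^ 2) * (E_series s m oo (fps_const (1 / real m ^ 2) * fps_X))"

definition O_scaled :: "nat \<Rightarrow> nat \<Rightarrow> real fps" where
  "O_scaled s m =
     fps_const (1 / real m) * (O_series s m oo (fps_const (1 / real m ^ 2) * fps_X))"

definition E_lim :: "nat \<Rightarrow> real fps" where
  "E_lim s = coeffwise_lim (E_scaled s)"

definition O_lim :: "nat \<Rightarrow> real fps" where
  "O_lim s = coeffwise_lim (O_scaled s)"

definition A_coeff :: "nat \<Rightarrow> nat \<Rightarrow> real" where
  "A_coeff s j = (real s + 1 - real j) ^ (2 * j) / fact (2 * j)"

definition B_coeff :: "nat \<Rightarrow> nat \<Rightarrow> real" where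
  "B_coeff s j = (real s + 1 - real j) ^ (2 * j + 1) / fact (2 * j + 1)"

definition Delta_vol :: "nat \<Rightarrow> real fps" where
  "Delta_vol s = (\<Sum>j=0..s. fps_const ((-1) ^ j * A_coeff s j) * fps_X ^ j)"

end

theory Submission
  imports Defs "HOL-Computational_Algebra.Formal_Laurent_Series"
begin

text \<open>Let $h_d(t)$ be the volume of the slice $x_{d+1} = t$ of the polytope cut out by the chain of
  constraints $x_i + x_{i+1} \le s + \delta_i$ in dimension $d+1$. Peeling off the last coordinate
  gives $h_0 = 1$ and $h_{d+1}(t) = \int_0^{s+\delta_{d+1}-t} h_d$ (the function \<open>slice\<close>), and the
  volume in dimension $d+1 \ge 2$ is $\int_0^{s+1} h_d$ (\<open>slice_total\<close>, lemma
  \<open>vol_polytope_Suc_Suc\<close>). Replacing the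
  integrals by sums over lattice points gives \<open>lattice_slice\<close>, whose totals are exactly the
  coefficients of the two parity-split series (\<open>O_series_nth\<close>, \<open>E_series_nth\<close>), because the row
  vector $\mathbf{e}^\top (I - z\mathsf{Z})^{-1}$ satisfies the same recursion. The $h_d$ are
  antitone, so these sums are Riemann sums with error $O(1/m)$, and the rescaled series converge
  coefficientwise to the generating functions of the $\int_0^{s+1} h_d$ for even and odd $d$
  (\<open>lattice_total_tendsto\<close>).

  It remains to compute these generating functions. Put $u = \sum_r h_{2r} z^r$ and
  $v = \sum_r h_{2r+1} z^r$. The recursion says $v(s-t) = \int_0^t u$ and
  $u(t) = u(0) - z \int_{-1}^{t-1} v(s-\tau)\,d\tau$; this is the delay equation
  $w''(t) = -z\,w(t-1)$ for $w(t) = v(s-t)$, with $w = 0$ on $[-1,0]$ and $w'(0) = u(0)$, which is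
  solved by truncated powers:
  $$u(t) = u(0) \sum_j (-z)^j \frac{(t-j)_+^{2j}}{(2j)!}, \qquad
    w(t) = u(0) \sum_j (-z)^j \frac{(t-j)_+^{2j+1}}{(2j+1)!}.$$
  Since $h_{2r}(s+1) = 0$ for $r \ge 1$, the boundary condition is $u(s+1) = 1$, which reads
  $u(0)\,\Delta_s^{\mathrm{vol}} = 1$. Integrating the
  formula for $u$ over $[0,s+1]$ gives the numerator with the $B_j$, and
  $\int_0^{s+1} h_{2r+1} = h_{2r+2}(0)$ gives $z\,\mathscr{E}_s = u(0) - 1$, hence the numerator with
  the $A_{j+1}$.\<close>

section \<open>Slice volumes\<close>

text \<open>The constraint between the coordinates $x_{d+1}$ and $x_{d+2}$ has index $d+1$, whence the
  argument of \<open>delta\<close>. An argument $t > s + \delta_{d+1}$ leaves an empty range of integration, so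
  that the truncation of the slices is built in.\<close>

fun slice :: "nat \<Rightarrow> nat \<Rightarrow> real \<Rightarrow> real" where
  "slice s 0 = (\<lambda>t. 1)"
| "slice s (Suc d) = (\<lambda>t. integral {0..real (s + delta (Suc d)) - t} (slice s d))"

text \<open>For negative bounds the interval is empty and the integral is zero, hence it agrees with the
  integral up to \<open>max 0 u\<close>; this extends the continuity known for bounds $u \ge 0$ to the whole
  line.\<close>

lemma continuous_on_integral_upto:
  fixes f :: "real \<Rightarrow> real"
  assumes "continuous_on UNIV f"
  shows "continuous_on UNIV (\<lambda>u. integral {0..u} f)"
proof -
  have "isCont (\<lambda>u. integral {0..u} f) x" for x
  proof -
    define b where "b = max 0 x + 1"
    have "continuous_on {0..b} (\<lambda>u. integral {0..u} f)"
      by (intro indefinite_integral_continuous_1 integrable_continuous_real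
            continuous_on_subset[OF assms]) auto
    hence "continuous_on {..<b} (\<lambda>u. integral {0..max 0 u} f)"
      by (rule continuous_on_compose2) (auto intro!: continuous_intros simp: b_def)
    moreover have "integral {0..max 0 u} f = integral {0..u} f" for u
      by (cases "u < 0") (auto simp: max_def)
    ultimately have "continuous_on {..<b} (\<lambda>u. integral {0..u} f)"
      by simp
    thus ?thesis
      by (simp add: continuous_on_eq_continuous_at b_def)
  qed
  thus ?thesis
    by (simp add: continuous_on_eq_continuous_at)
qed

lemma continuous_slice: "continuous_on UNIV (slice s d)"
proof (induction d)
  case (Suc d)
  have "continuous_on UNIV (\<lambda>t. integral {0..real (s + delta (Suc d)) - t} (slice s d))"
    by (rule continuous_on_compose2[OF continuous_on_integral_upto[OF Suc]])
       (auto intro!: continuous_intros)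
  thus ?case by simp
qed simp

lemma slice_integrable: "slice s d integrable_on {a..b}"
  by (intro integrable_continuous_real continuous_on_subset[OF continuous_slice]) auto

lemma slice_nonneg: "slice s d t \<ge> 0"
proof (induction d arbitrary: t)
  case (Suc d)
  show ?case
    by (simp add: integral_nonneg[OF slice_integrable] Suc)
qed simp

lemma antimono_slice: "antimono (slice s d)"
proof (cases d)
  case (Suc e)
  show ?thesis
    unfolding Suc
    by (intro antimonoI) (auto intro!: integral_subset_le slice_integrable slice_nonneg)
qed (auto intro: antimonoI)

section \<open>Closed form by truncated powers\<close>

text \<open>Normalised by the factorial, so that each function is the derivative of the next one. The value
  at zero matters only for \<open>k = 0\<close>: there it is $0^0 = 1$, because the leading term of the closed form
  is one on the whole of $[0,s+1]$.\<close>

definition truncated_power :: "nat \<Rightarrow> real \<Rightarrow> real" where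
  "truncated_power k u = (if u < 0 then 0 else u ^ k / fact k)"

text \<open>The start of integration must not lie to the right of the knot \<open>a\<close>, since only then does the
  antiderivative vanish there. For \<open>k = 0\<close> the integrand jumps at \<open>a\<close>, so that point is excluded in
  the fundamental theorem.\<close>

lemma truncated_power_has_integral:
  assumes "l \<le> a" "l \<le> t"
  shows "((\<lambda>x. truncated_power k (x - a)) has_integral truncated_power (Suc k) (t - a)) {l..t}"
proof -
  have eq: "truncated_power (Suc k) = (\<lambda>u. max 0 u ^ Suc k / fact (Suc k))"
    by (auto simp: truncated_power_def fun_eq_iff max_def)
  have "((\<lambda>x. truncated_power k (x - a)) has_integral
          (truncated_power (Suc k) (t - a) - truncated_power (Suc k) (l - a))) {l..t}"
  proof (rule fundamental_theorem_of_calculus_interior_strong[where S = "{a}"])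
    show "continuous_on {l..t} (\<lambda>x. truncated_power (Suc k) (x - a))"
      unfolding eq by (intro continuous_intros) auto
    fix x assume "x \<in> {l<..<t} - {a}"
    hence "x < a \<or> x > a" by auto
    thus "((\<lambda>x. truncated_power (Suc k) (x - a)) has_vector_derivative
            truncated_power k (x - a)) (at x)"
    proof
      assume x: "x < a"
      have "((\<lambda>x. truncated_power (Suc k) (x - a)) has_real_derivative 0) (at x)"
        by (rule has_field_derivative_transform_within_open[of "\<lambda>_. 0" _ _ "{..<a}"])
           (use x in \<open>auto simp: truncated_power_def\<close>)
      thus ?thesis
        using x by (simp add: truncated_power_def has_real_derivative_iff_has_vector_derivative)
    next
      assume x: "x > a"
      have "((\<lambda>x. (x - a) ^ Suc k / fact (Suc k)) has_real_derivative (x - a) ^ k / fact k) (at x)"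
      proof -
        have "((\<lambda>x. x - a) has_real_derivative 1) (at x)"
          by (auto intro!: derivative_eq_intros)
        from DERIV_power_Suc[OF this, of k]
        have "((\<lambda>x. (x - a) ^ Suc k) has_real_derivative real (Suc k) * (x - a) ^ k) (at x)"
          by simp
        from DERIV_cdivide[OF this, of "fact (Suc k)"] show ?thesis
          by (simp add: fact_Suc del: power_Suc of_nat_Suc)
      qed
      hence "((\<lambda>x. truncated_power (Suc k) (x - a)) has_real_derivative
               (x - a) ^ k / fact k) (at x)"
        by (rule has_field_derivative_transform_within_open[of _ _ _ "{a<..}"])
           (use x in \<open>auto simp: truncated_power_def\<close>)
      thus ?thesis
        using x by (simp add: truncated_power_def has_real_derivative_iff_has_vector_derivative)
    qed
  qed (use assms in auto)
  thus ?thesis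
    using assms by (simp add: eq)
qed

lemma truncated_power_reflected_has_integral:
  assumes "b \<le> c" "l \<le> c"
  shows "((\<lambda>x. truncated_power k (b - x)) has_integral truncated_power (Suc k) (b - l)) {l..c}"
proof -
  have "((\<lambda>x. truncated_power k (x - (- b))) has_integral
          truncated_power (Suc k) (- l - (- b))) {- c..- l}"
    by (rule truncated_power_has_integral) (use assms in auto)
  hence "((\<lambda>x. truncated_power k (- x - (- b))) has_integral
          truncated_power (Suc k) (- l - (- b))) {l..c}"
    by (subst (asm) has_integral_reflect_real[symmetric]) (use assms in auto)
  thus ?thesis by (simp add: algebra_simps)
qed

declare slice.simps(2) [simp del]

definition slice_at_0 :: "nat \<Rightarrow> nat \<Rightarrow> real" where
  "slice_at_0 s r = slice s (2 * r) 0"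

lemma slice_Suc_even: "slice s (Suc (2 * r)) t = integral {0..real s - t} (slice s (2 * r))"
  by (simp add: slice.simps delta_def)

lemma slice_Suc_odd:
  "slice s (Suc (Suc (2 * r))) t = integral {0..real s + 1 - t} (slice s (Suc (2 * r)))"
  by (subst slice.simps) (simp add: delta_def add.commute)

text \<open>Both families are integrals of each other, and each integration raises the exponent of every
  truncated power by one. An even slice is recovered from the preceding odd one by subtracting, from
  its value at zero, the integral over the top part of $[0,s+1]$; that integral shifts all knots by
  one and turns the convolution with the values at zero into the next one. The variable of the odd
  slices is reversed because their recursion integrates up to $s - t$.\<close>

lemma slice_truncated_power_formula:
  "(\<forall>t\<in>{0..real s + 1}. slice s (2 * r) t =
      (\<Sum>j\<le>r. slice_at_0 s (r - j) * (-1) ^ j * truncated_power (2 * j) (t - real j))) \<and>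
   (\<forall>t\<in>{-1..real s}. slice s (Suc (2 * r)) (real s - t) =
      (\<Sum>j\<le>r. slice_at_0 s (r - j) * (-1) ^ j * truncated_power (Suc (2 * j)) (t - real j)))"
  (is "?even r \<and> ?odd r")
proof -
  have odd: "?odd r" if even: "?even r" for r
  proof
    fix t assume t: "t \<in> {-1..real s}"
    show "slice s (Suc (2 * r)) (real s - t) =
      (\<Sum>j\<le>r. slice_at_0 s (r - j) * (-1) ^ j * truncated_power (Suc (2 * j)) (t - real j))"
    proof (cases "t < 0")
      case True
      thus ?thesis
        by (simp add: slice_Suc_even truncated_power_def)
    next
      case False
      have int: "((\<lambda>x. \<Sum>j\<le>r. slice_at_0 s (r - j) * (-1) ^ j * truncated_power (2 * j) (x - real j))
             has_integral
             (\<Sum>j\<le>r. slice_at_0 s (r - j) * (-1) ^ j * truncated_power (Suc (2 * j)) (t - real j)))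
             {0..t}"
        by (intro has_integral_sum has_integral_mult_right truncated_power_has_integral)
           (use False in auto)
      have "(slice s (2 * r) has_integral
          (\<Sum>j\<le>r. slice_at_0 s (r - j) * (-1) ^ j * truncated_power (Suc (2 * j)) (t - real j))) {0..t}"
        by (rule has_integral_eq[OF _ int]) (use even t in auto)
      hence "integral {0..t} (slice s (2 * r)) =
          (\<Sum>j\<le>r. slice_at_0 s (r - j) * (-1) ^ j * truncated_power (Suc (2 * j)) (t - real j))"
        by (rule integral_unique)
      thus ?thesis
        by (simp add: slice_Suc_even)
    qed
  qed
  have "?even r"
  proof (induction r)
    case 0
    show ?case by (simp add: slice_at_0_def truncated_power_def)
  next
    case (Suc r)
    show ?case
    proof
      fix t assume t: "t \<in> {0..real s + 1}"
      let ?g = "slice s (Suc (2 * r))"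
      have int: "((\<lambda>x. \<Sum>j\<le>r. slice_at_0 s (r - j) * (-1) ^ j *
                truncated_power (Suc (2 * j)) (real s - real j - x))
             has_integral
             (\<Sum>j\<le>r. slice_at_0 s (r - j) * (-1) ^ j *
                truncated_power (Suc (Suc (2 * j))) (real s - real j - (real s + 1 - t))))
             {real s + 1 - t..real s + 1}"
        by (intro has_integral_sum has_integral_mult_right
              truncated_power_reflected_has_integral) (use t in auto)
      have g_eq: "(\<Sum>j\<le>r. slice_at_0 s (r - j) * (-1) ^ j *
                truncated_power (Suc (2 * j)) (real s - real j - x)) = ?g x"
        if x: "x \<in> {real s + 1 - t..real s + 1}" for x
      proof -
        from x t have "real s - x \<in> {-1..real s}" by auto
        with odd[OF Suc] have "?g (real s - (real s - x)) = (\<Sum>j\<le>r. slice_at_0 s (r - j) * (-1) ^ j *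
            truncated_power (Suc (2 * j)) ((real s - x) - real j))"
          by blast
        thus ?thesis
          by (simp add: algebra_simps)
      qed
      have tail: "integral {real s + 1 - t..real s + 1} ?g =
          (\<Sum>j\<le>r. slice_at_0 s (r - j) * (-1) ^ j *
             truncated_power (Suc (Suc (2 * j))) (real s - real j - (real s + 1 - t)))"
        by (rule integral_unique[OF has_integral_eq[OF g_eq int]])
      have "integral {0..real s + 1 - t} ?g + integral {real s + 1 - t..real s + 1} ?g =
            integral {0..real s + 1} ?g"
        by (rule Henstock_Kurzweil_Integration.integral_combine)
           (use t in \<open>auto intro: slice_integrable\<close>)
      hence "slice s (2 * Suc r) t = slice_at_0 s (Suc r) - integral {real s + 1 - t..real s + 1} ?g"
        by (simp add: slice_at_0_def slice_Suc_odd)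
      also have "\<dots> = (\<Sum>j\<le>Suc r. slice_at_0 s (Suc r - j) * (-1) ^ j *
                         truncated_power (2 * j) (t - real j))"
        using t unfolding tail
        by (subst sum.atMost_Suc_shift)
           (simp add: truncated_power_def[of 0] sum_negf algebra_simps)
      finally show "slice s (2 * Suc r) t = (\<Sum>j\<le>Suc r. slice_at_0 s (Suc r - j) * (-1) ^ j *
                         truncated_power (2 * j) (t - real j))" .
    qed
  qed
  with odd show ?thesis by blast
qed

definition slice_total :: "nat \<Rightarrow> nat \<Rightarrow> real" where
  "slice_total s d = integral {0..real s + 1} (slice s d)"

text \<open>The step after an odd slice integrates over $[0, s+1-t]$, which at $t = 0$ is the whole
  interval.\<close>

lemma slice_total_odd: "slice_total s (Suc (2 * r)) = slice_at_0 s (Suc r)"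
  by (simp add: slice_total_def slice_at_0_def slice_Suc_odd)

lemma slice_total_even:
  "slice_total s (2 * r) =
    (\<Sum>j\<le>r. slice_at_0 s (r - j) * (-1) ^ j * truncated_power (Suc (2 * j)) (real s + 1 - real j))"
proof -
  have int: "((\<lambda>x. \<Sum>j\<le>r. slice_at_0 s (r - j) * (-1) ^ j * truncated_power (2 * j) (x - real j))
         has_integral
         (\<Sum>j\<le>r. slice_at_0 s (r - j) * (-1) ^ j * truncated_power (Suc (2 * j)) (real s + 1 - real j)))
         {0..real s + 1}"
    by (intro has_integral_sum has_integral_mult_right truncated_power_has_integral) auto
  have "(slice s (2 * r) has_integral
         (\<Sum>j\<le>r. slice_at_0 s (r - j) * (-1) ^ j * truncated_power (Suc (2 * j)) (real s + 1 - real j)))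
         {0..real s + 1}"
    by (rule has_integral_eq[OF _ int]) (use slice_truncated_power_formula[of s r] in auto)
  thus ?thesis
    unfolding slice_total_def by (rule integral_unique)
qed

section \<open>The generating functions of the slice totals\<close>

lemma fps_nth_sum_monom:
  "fps_nth (\<Sum>j=0..N. fps_const (f j) * fps_X ^ j) n = (if n \<le> N then f n else (0::'a::comm_ring_1))"
proof -
  have "fps_nth (\<Sum>j=0..N. fps_const (f j) * fps_X ^ j) n = (\<Sum>j=0..N. if j = n then f n else 0)"
    unfolding fps_sum_nth by (intro sum.cong) auto
  thus ?thesis by simp
qed

text \<open>At $j = s+1$ the truncated power is evaluated at zero and has positive degree, and beyond that
  its argument is negative; so the truncation stops the sums exactly at $j = s$.\<close>

lemma A_coeff_eq: "(if j \<le> s then A_coeff s j else 0) = truncated_power (2 * j) (real s + 1 - real j)"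
proof -
  consider "j \<le> s" | "j = Suc s" | "j > Suc s" by linarith
  thus ?thesis by cases (auto simp: A_coeff_def truncated_power_def)
qed

lemma B_coeff_eq:
  "(if j \<le> s then B_coeff s j else 0) = truncated_power (Suc (2 * j)) (real s + 1 - real j)"
proof -
  consider "j \<le> s" | "j = Suc s" | "j > Suc s" by linarith
  thus ?thesis by cases (auto simp: B_coeff_def truncated_power_def)
qed

lemma Delta_vol_nth:
  "fps_nth (Delta_vol s) j = (-1) ^ j * truncated_power (2 * j) (real s + 1 - real j)"
  unfolding Delta_vol_def fps_nth_sum_monom A_coeff_eq[symmetric] by auto

text \<open>The $r$-th coefficient of the product is the closed form of the even slice at $t = s+1$. There
  the recursion integrates over a single point, so the slice vanishes unless $r = 0$.\<close>

lemma slice_at_0_times_Delta_vol: "Abs_fps (slice_at_0 s) * Delta_vol s = 1"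
proof (rule fps_ext)
  fix r
  have "fps_nth (Abs_fps (slice_at_0 s) * Delta_vol s) r = slice s (2 * r) (real s + 1)"
    using slice_truncated_power_formula[of s r]
    by (subst mult.commute)
       (auto simp: fps_mult_nth Delta_vol_nth atLeast0AtMost mult_ac intro!: sum.cong)
  also have "\<dots> = fps_nth 1 r"
    by (cases r) (auto simp: slice_Suc_odd)
  finally show "fps_nth (Abs_fps (slice_at_0 s) * Delta_vol s) r = fps_nth 1 r" .
qed

lemma Delta_vol_nonzero: "Delta_vol s \<noteq> 0"
  using slice_at_0_times_Delta_vol[of s] by auto

lemma slice_total_even_gf:
  "Abs_fps (\<lambda>r. slice_total s (2 * r)) =
    (\<Sum>j=0..s. fps_const ((-1) ^ j * B_coeff s j) * fps_X ^ j) / Delta_vol s" (is "?O = ?N / _")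
proof -
  have "?N * Abs_fps (slice_at_0 s) = ?O"
  proof (rule fps_ext)
    fix r
    have coeff: "fps_nth ?N j = (-1) ^ j * truncated_power (Suc (2 * j)) (real s + 1 - real j)" for j
      unfolding fps_nth_sum_monom B_coeff_eq[symmetric] by auto
    show "fps_nth (?N * Abs_fps (slice_at_0 s)) r = fps_nth ?O r"
      unfolding fps_mult_nth coeff slice_total_even fps_nth_Abs_fps
      by (intro sum.cong) (auto simp: mult_ac)
  qed
  hence "?O * Delta_vol s = ?N"
    using slice_at_0_times_Delta_vol[of s] by (metis mult.assoc mult.right_neutral)
  thus ?thesis
    using Delta_vol_nonzero nonzero_mult_div_cancel_right by metis
qed

text \<open>By \<open>slice_total_odd\<close> the series is \<open>(K - 1) / fps_X\<close>, where \<open>K\<close> is the series of the slices at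
  zero, that is, the inverse of \<open>Delta_vol s\<close>. After multiplication with \<open>Delta_vol s\<close> the numerator
  is $(1 - \Delta)/z$, whose coefficients are those of $\Delta$ shifted by one and negated.\<close>

lemma slice_total_odd_gf:
  assumes "s \<ge> 1"
  shows "Abs_fps (\<lambda>r. slice_total s (Suc (2 * r))) =
    (\<Sum>j=0..s-1. fps_const ((-1) ^ j * A_coeff s (j + 1)) * fps_X ^ j) / Delta_vol s" (is "?E = ?N / _")
proof -
  have shifted: "fps_X * ?E = Abs_fps (slice_at_0 s) - 1"
  proof (rule fps_ext)
    fix r
    show "fps_nth (fps_X * ?E) r = fps_nth (Abs_fps (slice_at_0 s) - 1) r"
      by (cases r) (simp_all add: slice_total_odd slice_at_0_def)
  qed
  have "fps_X * ?N = 1 - Delta_vol s"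
  proof (rule fps_ext)
    fix j
    show "fps_nth (fps_X * ?N) j = fps_nth (1 - Delta_vol s) j"
    proof (cases j)
      case 0
      thus ?thesis by (simp add: Delta_vol_nth truncated_power_def)
    next
      case (Suc i)
      have "i \<le> s - 1 \<longleftrightarrow> Suc i \<le> s"
        using assms by auto
      thus ?thesis
        unfolding Suc by (auto simp: fps_nth_sum_monom Delta_vol_def)
    qed
  qed
  moreover have "fps_X * (?E * Delta_vol s) = 1 - Delta_vol s"
    using slice_at_0_times_Delta_vol[of s] unfolding mult.assoc[symmetric] shifted
    by (simp add: algebra_simps)
  ultimately have "fps_X * (?E * Delta_vol s) = fps_X * ?N"
    by simp
  hence "?E * Delta_vol s = ?N"
    by (simp only: mult_cancel_left fps_X_neq_zero simp_thms)
  thus ?thesis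
    using Delta_vol_nonzero nonzero_mult_div_cancel_right by metis
qed

section \<open>Lattice sums as Riemann sums\<close>

text \<open>On each step of length \<open>h\<close> the integral lies between \<open>h\<close> times the values at the two ends, so
  the excess of the sum over the integral decreases with \<open>n\<close> from its initial value \<open>h * f 0\<close>, and by
  at most the telescoping amount that leaves \<open>h * f (h * real n)\<close>.\<close>

lemma riemann_sum_antimono:
  fixes f :: "real \<Rightarrow> real"
  assumes anti: "antimono f" and nonneg: "\<And>x. f x \<ge> 0" and h: "h > 0"
    and int: "\<And>a b. f integrable_on {a..b}"
  shows "\<bar>h * (\<Sum>k\<le>n. f (h * real k)) - integral {0..h * real n} f\<bar> \<le> h * f 0"
proof -
  have "h * f (h * real n) \<le> h * (\<Sum>k\<le>n. f (h * real k)) - integral {0..h * real n} f \<and>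
        h * (\<Sum>k\<le>n. f (h * real k)) - integral {0..h * real n} f \<le> h * f 0"
  proof (induction n)
    case (Suc n)
    let ?a = "h * real n" and ?b = "h * real (Suc n)"
    have ab: "?a \<le> ?b" "?b - ?a = h"
      using h by (auto simp: algebra_simps)
    have split: "integral {0..?a} f + integral {?a..?b} f = integral {0..?b} f"
      by (rule Henstock_Kurzweil_Integration.integral_combine) (use h ab int in auto)
    have "integral {?a..?b} f \<le> integral {?a..?b} (\<lambda>_. f ?a)"
      by (rule integral_le) (auto intro: int antimonoD[OF anti])
    hence up: "integral {?a..?b} f \<le> h * f ?a"
      using ab by simp
    have "integral {?a..?b} (\<lambda>_. f ?b) \<le> integral {?a..?b} f"
      by (rule integral_le) (auto intro: int antimonoD[OF anti])
    hence low: "h * f ?b \<le> integral {?a..?b} f"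
      using ab by simp
    show ?case
      using Suc.IH split up low by (simp add: distrib_left)
  qed simp
  moreover have "h * f (h * real n) \<ge> 0"
    using h nonneg by simp
  ultimately show ?thesis by linarith
qed

text \<open>This is the number of lattice points in the $m$-fold dilate with last coordinate \<open>i\<close>, as a
  real number because it is compared with \<open>slice\<close>.\<close>

fun lattice_slice :: "nat \<Rightarrow> nat \<Rightarrow> nat \<Rightarrow> nat \<Rightarrow> real" where
  "lattice_slice s m 0 = (\<lambda>i. 1)"
| "lattice_slice s m (Suc d) =
    (\<lambda>i. \<Sum>j | i + j \<le> (s + delta (Suc d)) * m. lattice_slice s m d j)"

declare lattice_slice.simps(2) [simp del]

text \<open>Two errors add up: the at most $(s+2)m$ summands each carry the error \<open>K / m\<close> before
  the division by \<open>m\<close>, and the Riemann sum itself is off by at most \<open>slice s d 0 / m\<close>.\<close>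

lemma lattice_sum_error:
  assumes err: "\<And>i. i \<le> (s + 1) * m \<Longrightarrow>
      \<bar>lattice_slice s m d i / real m ^ d - slice s d (real i / real m)\<bar> \<le> K / real m"
    and m: "m \<ge> 1" and n: "n \<le> (s + 1) * m" and K: "K \<ge> 0"
  shows "\<bar>(\<Sum>j\<le>n. lattice_slice s m d j) / real m ^ Suc d - integral {0..real n / real m} (slice s d)\<bar>
           \<le> (real (s + 2) * K + slice s d 0) / real m"
proof -
  let ?S = "\<Sum>j\<le>n. slice s d (real j / real m)"
  have "\<bar>(\<Sum>j\<le>n. lattice_slice s m d j) / real m ^ d - ?S\<bar> =
        \<bar>\<Sum>j\<le>n. lattice_slice s m d j / real m ^ d - slice s d (real j / real m)\<bar>"
    by (simp add: sum_divide_distrib sum_subtractf)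
  also have "\<dots> \<le> (\<Sum>j\<le>n. \<bar>lattice_slice s m d j / real m ^ d - slice s d (real j / real m)\<bar>)"
    by (rule sum_abs)
  also have "\<dots> \<le> (\<Sum>j\<le>n. K / real m)"
    using n by (intro sum_mono err) auto
  also have "\<dots> = real (n + 1) * K / real m"
    by simp
  also have "\<dots> \<le> real ((s + 2) * m) * K / real m"
    using n m K by (intro divide_right_mono mult_right_mono) (simp_all del: of_nat_add of_nat_mult)
  also have "\<dots> = real (s + 2) * K"
    using m by (simp only: of_nat_mult) simp
  finally have "\<bar>(\<Sum>j\<le>n. lattice_slice s m d j) / real m ^ d - ?S\<bar> / real m
                  \<le> real (s + 2) * K / real m"
    by (rule divide_right_mono) simp
  moreover have "(\<Sum>j\<le>n. lattice_slice s m d j) / real m ^ Suc d - ?S / real m =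
                   ((\<Sum>j\<le>n. lattice_slice s m d j) / real m ^ d - ?S) / real m"
    by (simp add: diff_divide_distrib mult.commute)
  ultimately have 1: "\<bar>(\<Sum>j\<le>n. lattice_slice s m d j) / real m ^ Suc d - ?S / real m\<bar>
                  \<le> real (s + 2) * K / real m"
    by (simp only: abs_divide abs_of_nat)
  have 2: "\<bar>?S / real m - integral {0..real n / real m} (slice s d)\<bar> \<le> slice s d 0 / real m"
    using riemann_sum_antimono[OF antimono_slice slice_nonneg _ slice_integrable,
            of "1 / real m" s d n] m
    by simp
  from 1 2 show ?thesis
    unfolding add_divide_distrib by linarith
qed

text \<open>The constant must not depend on \<open>m\<close> or \<open>i\<close>, because the next step sums the error over about
  $m$ lattice points before dividing by $m$.\<close>

lemma lattice_slice_error: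
  "\<exists>K\<ge>0. \<forall>m\<ge>1. \<forall>i\<le>(s + 1) * m.
     \<bar>lattice_slice s m d i / real m ^ d - slice s d (real i / real m)\<bar> \<le> K / real m"
proof (induction d)
  case 0
  show ?case by (auto intro: exI[of _ 0])
next
  case (Suc d)
  then obtain K where K_all: "K \<ge> 0 \<and> (\<forall>m\<ge>1. \<forall>i\<le>(s + 1) * m.
     \<bar>lattice_slice s m d i / real m ^ d - slice s d (real i / real m)\<bar> \<le> K / real m)" ..
  have "K \<ge> 0" using K_all ..
  have K: "\<bar>lattice_slice s m d i / real m ^ d - slice s d (real i / real m)\<bar> \<le> K / real m"
    if "m \<ge> 1" "i \<le> (s + 1) * m" for m i
    using K_all that by simp
  define K' where "K' = real (s + 2) * K + slice s d 0"
  have K': "K' \<ge> 0"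
    using \<open>K \<ge> 0\<close> slice_nonneg by (simp add: K'_def)
  have main: "\<bar>lattice_slice s m (Suc d) i / real m ^ Suc d - slice s (Suc d) (real i / real m)\<bar>
          \<le> K' / real m"
    if m: "m \<ge> 1" and i: "i \<le> (s + 1) * m" for m i
  proof (cases "i \<le> (s + delta (Suc d)) * m")
    case True
    define n where "n = (s + delta (Suc d)) * m - i"
    have "delta (Suc d) \<le> 1" by (simp add: delta_def)
    hence "(s + delta (Suc d)) * m \<le> (s + 1) * m"
      by (intro mult_right_mono) auto
    hence n: "n \<le> (s + 1) * m"
      unfolding n_def by linarith
    have "{j. i + j \<le> (s + delta (Suc d)) * m} = {..n}"
      using True by (auto simp: n_def)
    hence 1: "lattice_slice s m (Suc d) i = (\<Sum>j\<le>n. lattice_slice s m d j)"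
      by (simp add: lattice_slice.simps)
    have "real n = real (s + delta (Suc d)) * real m - real i"
      unfolding n_def using True by (simp add: of_nat_diff)
    hence "real n / real m = real (s + delta (Suc d)) - real i / real m"
      using m by (simp add: field_simps)
    hence 2: "slice s (Suc d) (real i / real m) = integral {0..real n / real m} (slice s d)"
      by (simp add: slice.simps)
    show ?thesis
      unfolding 1 2 K'_def by (rule lattice_sum_error[OF K[OF m] m n \<open>K \<ge> 0\<close>])
  next
    case False
    hence "{j. i + j \<le> (s + delta (Suc d)) * m} = {}" by auto
    hence 1: "lattice_slice s m (Suc d) i = 0"
      by (simp only: lattice_slice.simps sum.empty)
    have "real ((s + delta (Suc d)) * m) < real i"
      using False by (simp del: of_nat_mult)
    hence "real (s + delta (Suc d)) < real i / real m"
      using m by (simp add: field_simps)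
    hence "slice s (Suc d) (real i / real m) = 0"
      by (simp add: slice.simps)
    with 1 K' show ?thesis by simp
  qed
  show ?case by (intro exI[of _ K'] conjI allI impI K' main)
qed

lemma lattice_total_tendsto:
  "(\<lambda>m. (\<Sum>i\<le>(s + 1) * m. lattice_slice s m d i) / real m ^ Suc d)
     \<longlonglongrightarrow> slice_total s d"
proof -
  obtain K where K_all: "K \<ge> 0 \<and> (\<forall>m\<ge>1. \<forall>i\<le>(s + 1) * m.
     \<bar>lattice_slice s m d i / real m ^ d - slice s d (real i / real m)\<bar> \<le> K / real m)"
    using lattice_slice_error[of s d] ..
  have "K \<ge> 0" using K_all ..
  have K: "\<bar>lattice_slice s m d i / real m ^ d - slice s d (real i / real m)\<bar> \<le> K / real m"
    if "m \<ge> 1" "i \<le> (s + 1) * m" for m i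
    using K_all that by simp
  define K' where "K' = real (s + 2) * K + slice s d 0"
  have "\<bar>(\<Sum>i\<le>(s + 1) * m. lattice_slice s m d i) / real m ^ Suc d
          - integral {0..real s + 1} (slice s d)\<bar> \<le> K' / real m" if m: "m \<ge> 1" for m
  proof -
    have "real ((s + 1) * m) / real m = real s + 1"
      using m by (simp only: of_nat_mult) simp
    thus ?thesis
      using lattice_sum_error[OF K[OF m] m order_refl \<open>K \<ge> 0\<close>] by (simp only: K'_def)
  qed
  hence "\<forall>\<^sub>F m in sequentially. norm ((\<Sum>i\<le>(s + 1) * m. lattice_slice s m d i) / real m ^ Suc d
          - integral {0..real s + 1} (slice s d)) \<le> K' / real m"
    by (auto intro!: eventually_sequentiallyI[of 1])
  from Lim_null_comparison[OF this lim_const_over_n] show ?thesis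
    unfolding slice_total_def by (rule LIM_zero_cancel)
qed

section \<open>Coefficients of the parity-split series\<close>

text \<open>The vector \<open>y\<close> is the row vector $\mathbf{e}^\top (I - zM)^{-1}$; multiplying by $I - zM$
  from the right gives $y = \mathbf{e}^\top + z\, y M$, which is the recursion for its
  coefficients. Working with rows makes the products arise in the same order as when the last
  coordinate of the polytope is peeled off, and one vector serves both series.\<close>

lemma resolvent_coeffs:
  fixes M :: "real mat"
  assumes M: "M \<in> carrier_mat n n"
  defines "y \<equiv> transpose_mat (mat_inv (I_minus_z M)) *\<^sub>v Matrix.vec n (\<lambda>_. 1)"
  shows resolvent_carrier: "mat_inv (I_minus_z M) \<in> carrier_mat n n"
    and resolvent_coeff_0: "k < n \<Longrightarrow> fps_nth (vec_index y k) 0 = 1"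
    and resolvent_coeff_Suc: "k < n \<Longrightarrow>
      fps_nth (vec_index y k) (Suc r) = (\<Sum>j<n. M $$ (j, k) * fps_nth (vec_index y j) r)"
proof -
  let ?A = "I_minus_z M" and ?B = "mat_inv (I_minus_z M)"
  let ?e = "Matrix.vec n (\<lambda>_. 1) :: real fps Matrix.vec"
  have A: "?A \<in> carrier_mat n n"
    using M by (auto simp: I_minus_z_def)
  note inv = mat_inv_I_minus_z[OF M]
  have AB: "?A * ?B = 1\<^sub>m n" and BA: "?B * ?A = 1\<^sub>m (dim_row ?B)"
    using inv A by (auto simp: inverts_mat_def)
  have "dim_col ?B = n"
    using arg_cong[OF AB, of dim_col] by simp
  moreover have "dim_row ?B = n"
    using arg_cong[OF BA, of dim_col] A by simp
  ultimately show B: "?B \<in> carrier_mat n n" by auto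
  have y: "y \<in> carrier_vec n"
    using B by (simp add: y_def)
  have "transpose_mat ?A *\<^sub>v y = (transpose_mat ?A * transpose_mat ?B) *\<^sub>v ?e"
    unfolding y_def using A B by simp
  also have "\<dots> = transpose_mat (?B * ?A) *\<^sub>v ?e"
    using A B by (subst transpose_mult[of _ n n _ n]) auto
  also have "\<dots> = ?e"
    using BA B by simp
  finally have eq: "transpose_mat ?A *\<^sub>v y = ?e" .
  have yk: "vec_index y k = 1 + fps_X * (\<Sum>j<n. fps_const (M $$ (j, k)) * vec_index y j)"
    if k: "k < n" for k
  proof -
    have "1 = vec_index (transpose_mat ?A *\<^sub>v y) k"
      unfolding eq using k by simp
    also have "\<dots> = (\<Sum>j<n. ?A $$ (j, k) * vec_index y j)"
      using A y k by (simp add: scalar_prod_def atLeast0LessThan)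
    also have "\<dots> = (\<Sum>j<n. (if j = k then vec_index y j else 0)
                            - fps_X * (fps_const (M $$ (j, k)) * vec_index y j))"
      using M k by (intro sum.cong) (auto simp: I_minus_z_def algebra_simps)
    also have "\<dots> = vec_index y k - fps_X * (\<Sum>j<n. fps_const (M $$ (j, k)) * vec_index y j)"
      using k by (simp add: sum_subtractf sum_distrib_left)
    finally show ?thesis by (simp add: algebra_simps)
  qed
  show "fps_nth (vec_index y k) 0 = 1" if "k < n"
    by (subst yk[OF that]) simp
  show "fps_nth (vec_index y k) (Suc r) = (\<Sum>j<n. M $$ (j, k) * fps_nth (vec_index y j) r)" if "k < n"
    by (subst yk[OF that]) (simp add: fps_sum_nth)
qed

lemma resolvent_scalar_prod:
  fixes M :: "real mat"
  assumes M: "M \<in> carrier_mat n n" and w: "w \<in> carrier_vec n"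
  shows
    "scalar_prod (Matrix.vec n (\<lambda>_. 1)) (mat_inv (I_minus_z M) *\<^sub>v w) =
     (\<Sum>j<n. vec_index (transpose_mat (mat_inv (I_minus_z M)) *\<^sub>v Matrix.vec n (\<lambda>_. 1)) j * vec_index w j)"
proof -
  let ?B = "mat_inv (I_minus_z M)"
  let ?e = "Matrix.vec n (\<lambda>_. 1) :: real fps Matrix.vec"
  have B: "?B \<in> carrier_mat n n" by (rule resolvent_carrier[OF M])
  have "scalar_prod ?e (?B *\<^sub>v w) = scalar_prod (transpose_mat ?B *\<^sub>v ?e) w"
    by (rule transpose_vec_mult_scalar[OF B w, symmetric]) simp
  thus ?thesis
    using w by (simp add: scalar_prod_def atLeast0LessThan)
qed

lemma X_mat_sum:
  assumes "l < (s + 1) * m + 1"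
  shows "(\<Sum>j<(s + 1) * m + 1. X_mat s m $$ (j, l) * lattice_slice s m (2 * r) j) =
           lattice_slice s m (Suc (2 * r)) l"
proof -
  let ?N = "(s + 1) * m + 1"
  have "(\<Sum>j<?N. X_mat s m $$ (j, l) * lattice_slice s m (2 * r) j) =
        (\<Sum>j<?N. if l + j \<le> s * m then lattice_slice s m (2 * r) j else 0)"
    using assms by (intro sum.cong) (auto simp: X_mat_def)
  also have "\<dots> = (\<Sum>j | j \<in> {..<?N} \<and> l + j \<le> s * m. lattice_slice s m (2 * r) j)"
    by (subst sum.inter_filter) auto
  also have "{j. j \<in> {..<?N} \<and> l + j \<le> s * m} = {j. l + j \<le> (s + delta (Suc (2 * r))) * m}"
    by (auto simp: delta_def)
  finally show ?thesis by (simp add: lattice_slice.simps)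
qed

lemma Y_mat_sum:
  assumes "l < (s + 1) * m + 1"
  shows "(\<Sum>j<(s + 1) * m + 1. Y_mat s m $$ (j, l) * lattice_slice s m (Suc (2 * r)) j) =
           lattice_slice s m (2 * Suc r) l"
proof -
  let ?N = "(s + 1) * m + 1"
  have "(\<Sum>j<?N. Y_mat s m $$ (j, l) * lattice_slice s m (Suc (2 * r)) j) =
        (\<Sum>j<?N. if l + j \<le> (s + 1) * m then lattice_slice s m (Suc (2 * r)) j else 0)"
    using assms by (intro sum.cong) (auto simp: Y_mat_def)
  also have "\<dots> = (\<Sum>j | j \<in> {..<?N} \<and> l + j \<le> (s + 1) * m. lattice_slice s m (Suc (2 * r)) j)"
    by (subst sum.inter_filter) auto
  also have "{j. j \<in> {..<?N} \<and> l + j \<le> (s + 1) * m} =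
             {j. l + j \<le> (s + delta (Suc (Suc (2 * r)))) * m}"
    by (auto simp: delta_def)
  finally show ?thesis by (simp add: lattice_slice.simps(2)[of _ _ "Suc (2 * r)"])
qed

lemma Z_mat_carrier: "Z_mat s m \<in> carrier_mat ((s + 1) * m + 1) ((s + 1) * m + 1)"
  unfolding Z_mat_def X_mat_def Y_mat_def by (rule mult_carrier_mat[OF mat_carrier mat_carrier])

definition resolvent_row :: "nat \<Rightarrow> nat \<Rightarrow> real fps Matrix.vec" where
  "resolvent_row s m = transpose_mat (mat_inv (I_minus_z (Z_mat s m))) *\<^sub>v e_vec s m"

text \<open>Applying \<open>Z_mat s m\<close> to a row means applying \<open>X_mat s m\<close> and then \<open>Y_mat s m\<close>, that is, passing
  from an even lattice slice to the next odd one and from there to the next even one.\<close>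

lemma resolvent_row_nth:
  assumes "k < (s + 1) * m + 1"
  shows "fps_nth (vec_index (resolvent_row s m) k) r = lattice_slice s m (2 * r) k"
  using assms
proof (induction r arbitrary: k)
  case 0
  thus ?case
    using resolvent_coeff_0[OF Z_mat_carrier, of k s m]
    by (simp add: resolvent_row_def e_vec_def)
next
  case (Suc r)
  let ?N = "(s + 1) * m + 1"
  let ?f = "lattice_slice s m (2 * r)"
  have "fps_nth (vec_index (resolvent_row s m) k) (Suc r)
          = (\<Sum>j<?N. Z_mat s m $$ (j, k) * fps_nth (vec_index (resolvent_row s m) j) r)"
    unfolding resolvent_row_def e_vec_def
    by (rule resolvent_coeff_Suc[OF Z_mat_carrier Suc.prems])
  also have "\<dots> = (\<Sum>j<?N. Z_mat s m $$ (j, k) * ?f j)"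
    by (intro sum.cong refl arg_cong2[where f = "(*)"] Suc.IH) (simp only: lessThan_iff)
  also have "\<dots> = (\<Sum>j<?N. (\<Sum>l<?N. X_mat s m $$ (j, l) * Y_mat s m $$ (l, k)) * ?f j)"
    using Suc.prems
    by (intro sum.cong)
       (auto simp: Z_mat_def X_mat_def Y_mat_def scalar_prod_def atLeast0LessThan)
  also have "\<dots> = (\<Sum>l<?N. \<Sum>j<?N. Y_mat s m $$ (l, k) * (X_mat s m $$ (j, l) * ?f j))"
    unfolding sum_distrib_right by (subst sum.swap) (simp add: mult_ac)
  also have "\<dots> = (\<Sum>l<?N. Y_mat s m $$ (l, k) * lattice_slice s m (Suc (2 * r)) l)"
    unfolding sum_distrib_left[symmetric]
    by (intro sum.cong refl arg_cong2[where f = "(*)"] X_mat_sum) (simp only: lessThan_iff)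
  also have "\<dots> = lattice_slice s m (2 * Suc r) k"
    by (rule Y_mat_sum[OF Suc.prems])
  finally show ?case .
qed

lemma O_series_nth:
  "fps_nth (O_series s m) r = (\<Sum>i\<le>(s + 1) * m. lattice_slice s m (2 * r) i)"
proof -
  let ?N = "(s + 1) * m + 1"
  have "O_series s m = (\<Sum>j<?N. vec_index (resolvent_row s m) j * vec_index (e_vec s m) j)"
    unfolding O_series_def e_vec_def resolvent_row_def
    by (rule resolvent_scalar_prod[OF Z_mat_carrier]) simp
  also have "\<dots> = (\<Sum>j<?N. vec_index (resolvent_row s m) j)"
    by (intro sum.cong) (auto simp: e_vec_def)
  finally have "fps_nth (O_series s m) r = (\<Sum>j<?N. fps_nth (vec_index (resolvent_row s m) j) r)"
    by (simp only: fps_sum_nth)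
  also have "\<dots> = (\<Sum>j<?N. lattice_slice s m (2 * r) j)"
    by (intro sum.cong refl resolvent_row_nth) (simp only: lessThan_iff)
  finally show ?thesis
    by (simp add: lessThan_Suc_atMost)
qed

lemma fps_nth_mult_const_sum:
  fixes f :: "real fps" and N :: nat
  shows "fps_nth (f * (\<Sum>l<N. fps_const (c l))) r = (\<Sum>l<N. c l * fps_nth f r)"
proof (induction N)
  case (Suc N)
  have "fps_nth (f * (\<Sum>l<Suc N. fps_const (c l))) r =
        fps_nth (f * (\<Sum>l<N. fps_const (c l))) r + fps_nth f r * c N"
    by (simp only: sum.lessThan_Suc distrib_left fps_add_nth fps_mult_right_const_nth)
  thus ?case
    by (simp only: Suc.IH sum.lessThan_Suc mult.commute)
qed simp

text \<open>The factor \<open>X_mat s m\<close> behind the resolvent is absorbed into the row vector and turns its even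
  lattice slices into the odd ones.\<close>

lemma E_series_nth:
  "fps_nth (E_series s m) r = (\<Sum>i\<le>(s + 1) * m. lattice_slice s m (Suc (2 * r)) i)"
proof -
  let ?N = "(s + 1) * m + 1"
  let ?w = "map_mat fps_const (X_mat s m) *\<^sub>v e_vec s m"
  have w: "vec_index ?w j = (\<Sum>l<?N. fps_const (X_mat s m $$ (j, l)))" if "j < ?N" for j
    using that
    by (auto simp: X_mat_def e_vec_def scalar_prod_def atLeast0LessThan intro!: sum.cong)
  have w_carrier: "?w \<in> carrier_vec ?N"
    unfolding X_mat_def e_vec_def
    by (rule mult_mat_vec_carrier[OF _ vec_carrier]) (simp only: map_carrier_mat mat_carrier)
  have "E_series s m = (\<Sum>j<?N. vec_index (resolvent_row s m) j * vec_index ?w j)"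
    using resolvent_scalar_prod[OF Z_mat_carrier w_carrier]
    by (simp only: E_series_def e_vec_def resolvent_row_def)
  also have "\<dots> = (\<Sum>j<?N. vec_index (resolvent_row s m) j *
                     (\<Sum>l<?N. fps_const (X_mat s m $$ (j, l))))"
    by (intro sum.cong refl arg_cong2[where f = "(*)"] w) (simp only: lessThan_iff)
  finally have E: "E_series s m = (\<Sum>j<?N. vec_index (resolvent_row s m) j *
                     (\<Sum>l<?N. fps_const (X_mat s m $$ (j, l))))" .
  have "fps_nth (E_series s m) r =
      (\<Sum>j<?N. \<Sum>l<?N. X_mat s m $$ (j, l) * fps_nth (vec_index (resolvent_row s m) j) r)"
    by (simp only: E fps_sum_nth fps_nth_mult_const_sum)
  also have "\<dots> = (\<Sum>l<?N. \<Sum>j<?N. X_mat s m $$ (j, l) * lattice_slice s m (2 * r) j)"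
    by (subst sum.swap)
       (intro sum.cong refl arg_cong2[where f = "(*)"] resolvent_row_nth, simp only: lessThan_iff)
  also have "\<dots> = (\<Sum>l<?N. lattice_slice s m (Suc (2 * r)) l)"
    by (intro sum.cong refl X_mat_sum) (simp only: lessThan_iff)
  finally show ?thesis
    by (simp add: lessThan_Suc_atMost)
qed

section \<open>Volumes by iterated integration\<close>

text \<open>In contrast to \<open>polytope\<close>, dimension one is the full ray $[0,\infty)$, which is the base case
  of the iterated integration.\<close>

definition chain_polytope :: "nat \<Rightarrow> nat \<Rightarrow> (nat \<Rightarrow> real) set" where
  "chain_polytope s d = {x \<in> {1..d} \<rightarrow>\<^sub>E {0..}. \<forall>i\<in>{1..<d}. x i + x (i + 1) \<le> real (s + delta i)}"

lemma chain_polytope_sets [measurable]: "chain_polytope s d \<in> sets (Pi\<^sub>M {1..d} (\<lambda>_. lborel))"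
proof -
  let ?M = "Pi\<^sub>M {1..d} (\<lambda>_. lborel :: real measure)"
  have "chain_polytope s d = {x \<in> space ?M. (\<forall>i\<in>{1..d}. 0 \<le> x i) \<and>
                        (\<forall>i\<in>{1..<d}. x i + x (i + 1) \<le> real (s + delta i))}"
    by (auto simp: chain_polytope_def space_PiM PiE_def extensional_def)
  moreover have "Measurable.pred ?M (\<lambda>x. 0 \<le> x i)" if "i \<in> {1..d}" for i
  proof -
    have [measurable]: "(\<lambda>x. x i) \<in> borel_measurable ?M"
      using measurable_component_singleton[OF that, of "\<lambda>_. lborel :: real measure"] by simp
    show ?thesis by measurable
  qed
  moreover have "Measurable.pred ?M (\<lambda>x. x i + x (i + 1) \<le> real (s + delta i))"
    if "i \<in> {1..<d}" for i
  proof -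
    have i: "i \<in> {1..d}" "i + 1 \<in> {1..d}" using that by auto
    have [measurable]: "(\<lambda>x. x i) \<in> borel_measurable ?M" "(\<lambda>x. x (i + 1)) \<in> borel_measurable ?M"
      using i[THEN measurable_component_singleton, of "\<lambda>_. lborel :: real measure"] by simp_all
    show ?thesis by measurable
  qed
  ultimately show ?thesis
    by (auto intro!: sets.sets_Collect_conj sets.sets_Collect_finite_All simp: pred_def)
qed

text \<open>A point extended by one coordinate gains only the constraints that involve this coordinate.
  This separates the new variable from all old ones except the last.\<close>

lemma chain_polytope_Suc_iff:
  assumes "x \<in> {1..Suc d} \<rightarrow>\<^sub>E UNIV"
  shows "x(Suc (Suc d) := y) \<in> chain_polytope s (Suc (Suc d)) \<longleftrightarrow>
    x \<in> chain_polytope s (Suc d) \<and> 0 \<le> y \<and> x (Suc d) + y \<le> real (s + delta (Suc d))"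
proof -
  have 1: "{1..Suc (Suc d)} = insert (Suc (Suc d)) {1..Suc d}"
    and 2: "{1..<Suc (Suc d)} = insert (Suc d) {1..<Suc d}" by auto
  show ?thesis
    unfolding chain_polytope_def 1 2 using assms by (auto simp: PiE_def extensional_def Pi_def)
qed

interpretation lborel_prod: product_sigma_finite "\<lambda>_::nat. lborel :: real measure"
  by (simp add: product_sigma_finite_def lborel.sigma_finite_measure_axioms)

lemma slice_measurable [measurable]: "slice s d \<in> borel_measurable borel"
  by (rule borel_measurable_continuous_onI[OF continuous_slice])

lemma nn_integral_slice_upto:
  "(\<integral>\<^sup>+t. indicator {0..} t * ennreal (slice s d t) * indicator {..u} t \<partial>lborel)
     = ennreal (integral {0..u} (slice s d))"
proof -
  have "(\<integral>\<^sup>+t. indicator {0..} t * ennreal (slice s d t) * indicator {..u} t \<partial>lborel) =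
        (\<integral>\<^sup>+t. ennreal (indicator {0..u} t * slice s d t) \<partial>lborel)"
    by (intro nn_integral_cong) (auto simp: indicator_def)
  also have "\<dots> = ennreal (integral {0..u} (slice s d))"
    by (rule nn_integral_has_integral_lebesgue[OF slice_nonneg integrable_integral[OF slice_integrable]])
  finally show ?thesis .
qed

text \<open>The distribution of the last coordinate has density \<open>slice s d\<close>. Testing against an arbitrary \<open>g\<close>
  makes the induction work: when the next coordinate is integrated last, the constraint that couples it
  to its predecessor becomes part of the test function of the induction hypothesis.\<close>

lemma nn_integral_chain_polytope:
  assumes [measurable]: "g \<in> borel_measurable borel"
  shows "(\<integral>\<^sup>+x. indicator (chain_polytope s (Suc d)) x * g (x (Suc d)) \<partial>Pi\<^sub>M {1..Suc d} (\<lambda>_. lborel))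
           = (\<integral>\<^sup>+t. indicator {0..} t * ennreal (slice s d t) * g t \<partial>lborel)"
  using assms
proof (induction d arbitrary: g)
  case 0
  note [measurable] = 0
  have "(\<integral>\<^sup>+x. indicator (chain_polytope s 1) x * g (x 1) \<partial>Pi\<^sub>M {1..1} (\<lambda>_. lborel))
          = (\<integral>\<^sup>+x. indicator {0..} (x 1) * g (x 1) \<partial>Pi\<^sub>M {1::nat} (\<lambda>_. lborel))"
    unfolding atLeastAtMost_singleton
    by (intro nn_integral_cong) (auto simp: chain_polytope_def space_PiM indicator_def PiE_def Pi_def)
  also have "\<dots> = (\<integral>\<^sup>+t. indicator {0..} t * g t \<partial>lborel)"
    by (rule lborel_prod.product_nn_integral_singleton) measurable
  finally show ?case by simp
next
  case (Suc d)
  note [measurable] = Suc.prems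
  let ?n = "Suc (Suc d)" and ?c = "real (s + delta (Suc d))"
  let ?M = "\<lambda>d. Pi\<^sub>M {1..d} (\<lambda>_. lborel :: real measure)"
  have ins: "{1..?n} = insert ?n {1..Suc d}" by auto
  have comp: "(\<lambda>x. x ?n) \<in> borel_measurable (?M ?n)"
    using measurable_component_singleton[of ?n "{1..?n}" "\<lambda>_. lborel :: real measure"] by simp
  have meas: "(\<lambda>x. indicator (chain_polytope s ?n) x * g (x ?n)) \<in> borel_measurable (?M ?n)"
    by (intro borel_measurable_times_ennreal borel_measurable_indicator chain_polytope_sets
          measurable_compose[OF comp Suc.prems])
  have "(\<integral>\<^sup>+x. indicator (chain_polytope s ?n) x * g (x ?n) \<partial>?M ?n) =
        (\<integral>\<^sup>+y. \<integral>\<^sup>+x. indicator (chain_polytope s ?n) (x(?n := y)) * g ((x(?n := y)) ?n) \<partial>?M (Suc d) \<partial>lborel)"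
    using meas unfolding ins by (intro lborel_prod.product_nn_integral_insert_rev) auto
  also have "\<dots> = (\<integral>\<^sup>+y. \<integral>\<^sup>+x. indicator (chain_polytope s (Suc d)) x * (indicator {..?c - y} (x (Suc d))
                       * (indicator {0..} y * g y)) \<partial>?M (Suc d) \<partial>lborel)"
  proof (intro nn_integral_cong)
    fix y x assume "x \<in> space (?M (Suc d))"
    hence "x \<in> {1..Suc d} \<rightarrow>\<^sub>E UNIV" by (simp add: space_PiM)
    from chain_polytope_Suc_iff[OF this, of y s]
    show "indicator (chain_polytope s ?n) (x(?n := y)) * g ((x(?n := y)) ?n) =
          indicator (chain_polytope s (Suc d)) x * (indicator {..?c - y} (x (Suc d)) * (indicator {0..} y * g y))"
      by (auto simp: indicator_def)
  qed
  also have "\<dots> = (\<integral>\<^sup>+y. \<integral>\<^sup>+t. indicator {0..} t * ennreal (slice s d t) *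
                       (indicator {..?c - y} t * (indicator {0..} y * g y)) \<partial>lborel \<partial>lborel)"
  proof (intro nn_integral_cong)
    fix y :: real
    show "(\<integral>\<^sup>+x. indicator (chain_polytope s (Suc d)) x * (indicator {..?c - y} (x (Suc d))
                       * (indicator {0..} y * g y)) \<partial>?M (Suc d)) =
          (\<integral>\<^sup>+t. indicator {0..} t * ennreal (slice s d t) *
                       (indicator {..?c - y} t * (indicator {0..} y * g y)) \<partial>lborel)"
      by (rule Suc.IH) measurable
  qed
  also have "\<dots> = (\<integral>\<^sup>+y. (\<integral>\<^sup>+t. indicator {0..} t * ennreal (slice s d t) * indicator {..?c - y} t \<partial>lborel)
                       * (indicator {0..} y * g y) \<partial>lborel)"
  proof (intro nn_integral_cong)
    fix y :: real
    have "(\<integral>\<^sup>+t. indicator {0..} t * ennreal (slice s d t) *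
                       (indicator {..?c - y} t * (indicator {0..} y * g y)) \<partial>lborel) =
          (\<integral>\<^sup>+t. (indicator {0..} t * ennreal (slice s d t) * indicator {..?c - y} t) *
                       (indicator {0..} y * g y) \<partial>lborel)"
      by (simp only: mult.assoc)
    also have "\<dots> = (\<integral>\<^sup>+t. indicator {0..} t * ennreal (slice s d t) *
                       indicator {..?c - y} t \<partial>lborel) * (indicator {0..} y * g y)"
      by (rule nn_integral_multc) measurable
    finally show "(\<integral>\<^sup>+t. indicator {0..} t * ennreal (slice s d t) *
                       (indicator {..?c - y} t * (indicator {0..} y * g y)) \<partial>lborel) =
        (\<integral>\<^sup>+t. indicator {0..} t * ennreal (slice s d t) *
                       indicator {..?c - y} t \<partial>lborel) * (indicator {0..} y * g y)" .
  qed
  also have "\<dots> = (\<integral>\<^sup>+y. indicator {0..} y * ennreal (slice s (Suc d) y) * g y \<partial>lborel)"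
    unfolding nn_integral_slice_upto by (simp add: slice.simps mult_ac)
  finally show ?case .
qed

text \<open>Points of the polytope have all coordinates at most $s+1$ from dimension two on, so that the
  integral over the ray reduces to \<open>slice_total\<close>.\<close>

lemma slice_eq_0: "t > real s + 1 \<Longrightarrow> slice s (Suc d) t = 0"
  by (simp add: slice.simps delta_def)

lemma vol_chain_polytope: "vol (Suc (Suc d)) (chain_polytope s (Suc (Suc d))) = slice_total s (Suc d)"
proof -
  let ?n = "Suc (Suc d)"
  have "emeasure (Pi\<^sub>M {1..?n} (\<lambda>_. lborel)) (chain_polytope s ?n) =
        (\<integral>\<^sup>+x. indicator (chain_polytope s ?n) x * 1 \<partial>Pi\<^sub>M {1..?n} (\<lambda>_. lborel))"
    by (simp only: mult_1_right nn_integral_indicator[OF chain_polytope_sets])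
  also have "\<dots> = (\<integral>\<^sup>+t. indicator {0..} t * ennreal (slice s (Suc d) t) * 1 \<partial>lborel)"
    by (rule nn_integral_chain_polytope) simp
  also have "\<dots> = (\<integral>\<^sup>+t. indicator {0..} t * ennreal (slice s (Suc d) t)
                          * indicator {..real s + 1} t \<partial>lborel)"
    by (intro nn_integral_cong) (auto simp: indicator_def slice_eq_0)
  also have "\<dots> = ennreal (slice_total s (Suc d))"
    unfolding nn_integral_slice_upto slice_total_def ..
  finally show ?thesis
    unfolding vol_def
    by (simp add: measure_def slice_total_def integral_nonneg[OF slice_integrable slice_nonneg])
qed

lemma vol_polytope_0: "vol 0 (polytope s 0) = 1"
  by (simp add: vol_def polytope_def measure_def PiM_empty)

lemma vol_polytope_1: "vol 1 (polytope s 1) = real s"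
proof -
  have "emeasure (Pi\<^sub>M {1..1::nat} (\<lambda>_. lborel)) ({1..1} \<rightarrow>\<^sub>E {0..real s}) = ennreal (real s)"
    by (subst lborel_prod.emeasure_PiM) auto
  thus ?thesis
    by (simp add: vol_def polytope_def measure_def)
qed

lemma vol_polytope_Suc_Suc: "vol (Suc (Suc d)) (polytope s (Suc (Suc d))) = slice_total s (Suc d)"
  using vol_chain_polytope[of d s] by (simp add: polytope_def chain_polytope_def)

section \<open>The limits and the volume generating function\<close>

lemma E_scaled_nth:
  "fps_nth (E_scaled s m) r =
     (\<Sum>i\<le>(s + 1) * m. lattice_slice s m (Suc (2 * r)) i) / real m ^ Suc (Suc (2 * r))"
  unfolding E_scaled_def fps_mult_left_const_nth fps_nth_compose_linear E_series_nth
  by (simp add: power_one_over power_mult power2_eq_square)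

lemma O_scaled_nth:
  "fps_nth (O_scaled s m) r =
     (\<Sum>i\<le>(s + 1) * m. lattice_slice s m (2 * r) i) / real m ^ Suc (2 * r)"
  unfolding O_scaled_def fps_mult_left_const_nth fps_nth_compose_linear O_series_nth
  by (simp add: power_one_over power_mult[symmetric] mult_ac)

lemma coeffwise_limit_imp_lim_eq:
  assumes "coeffwise_limit F G"
  shows "coeffwise_lim F = G"
  using assms by (intro fps_ext) (simp add: coeffwise_limit_def coeffwise_lim_def limI)

lemma E_scaled_limit:
  "coeffwise_limit (E_scaled s) (Abs_fps (\<lambda>r. slice_total s (Suc (2 * r))))"
  unfolding coeffwise_limit_def E_scaled_nth fps_nth_Abs_fps
  by (intro allI lattice_total_tendsto)

lemma O_scaled_limit:
  "coeffwise_limit (O_scaled s) (Abs_fps (\<lambda>r. slice_total s (2 * r)))"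
  unfolding coeffwise_limit_def O_scaled_nth fps_nth_Abs_fps
  by (intro allI lattice_total_tendsto)

text \<open>The case distinction is on the parity of the dimension, which decides the series that
  supplies the coefficient; dimension one is separate because the polytope there is
  $[0,s]$, one unit shorter than the interval $[0,s+1]$ that contributes to the constant term of
  the odd series.\<close>

lemma vol_gf_eq:
  "vol_gf s = 1 + fps_X * ((Abs_fps (\<lambda>r. slice_total s (2 * r)) oo fps_X ^ 2) - 1)
                + fps_X ^ 2 * (Abs_fps (\<lambda>r. slice_total s (Suc (2 * r))) oo fps_X ^ 2)"
  (is "_ = 1 + fps_X * (?O - 1) + fps_X ^ 2 * ?E")
proof (rule fps_ext)
  fix n
  consider "n = 0" | "n = 1" | d where "n = Suc (Suc d)"
    by (metis One_nat_def not0_implies_Suc)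
  thus "fps_nth (vol_gf s) n = fps_nth (1 + fps_X * (?O - 1) + fps_X ^ 2 * ?E) n"
  proof cases
    case 1
    thus ?thesis
      by (simp add: vol_gf_def vol_polytope_0 fps_X_power_mult_nth)
  next
    case 2
    thus ?thesis
      using vol_polytope_1[of s]
      by (simp add: vol_gf_def fps_X_power_mult_nth slice_total_def)
  next
    case 3
    show ?thesis
    proof (cases "even d")
      case True
      then obtain k where "d = 2 * k" by (elim evenE)
      thus ?thesis
        using 3 by (simp add: vol_gf_def vol_polytope_Suc_Suc fps_X_power_mult_nth
                      fps_nth_compose_X_power)
    next
      case False
      then obtain k where "d = 2 * k + 1" by (elim oddE)
      thus ?thesis
        using 3 by (simp add: vol_gf_def vol_polytope_Suc_Suc fps_X_power_mult_nth
                      fps_nth_compose_X_power)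
    qed
  qed
qed

theorem corollary3p7:
  fixes s :: nat
  assumes "s \<ge> 1"
  shows "coeffwise_limit (E_scaled s) (E_lim s)
    \<and> coeffwise_limit (O_scaled s) (O_lim s)
    \<and> E_lim s =
        (\<Sum>j=0..s-1. fps_const ((-1) ^ j * A_coeff s (j + 1)) * fps_X ^ j) / Delta_vol s
    \<and> O_lim s =
        (\<Sum>j=0..s. fps_const ((-1) ^ j * B_coeff s j) * fps_X ^ j) / Delta_vol s
    \<and> vol_gf s =
        1 + fps_X * ((O_lim s oo fps_X ^ 2) - 1) + fps_X ^ 2 * (E_lim s oo fps_X ^ 2)"
proof -
  have E: "E_lim s = Abs_fps (\<lambda>r. slice_total s (Suc (2 * r)))"
    unfolding E_lim_def by (rule coeffwise_limit_imp_lim_eq[OF E_scaled_limit])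
  have O: "O_lim s = Abs_fps (\<lambda>r. slice_total s (2 * r))"
    unfolding O_lim_def by (rule coeffwise_limit_imp_lim_eq[OF O_scaled_limit])
  show ?thesis
    unfolding E O
    by (intro conjI E_scaled_limit O_scaled_limit slice_total_odd_gf[OF assms]
          slice_total_even_gf vol_gf_eq)
qed

end
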